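(* Let $X$ and $Y$ be non-negative independent random variables with probability density functions, for $x>0$ and $y>0$, $$f(x)=x^{\alpha-1}\sum_{m=1}^{M}a_{m}e^{-\xi_{m}x},\qquad g(y)=y^{\beta-1}\sum_{n=1}^{N}b_{n}e^{-\eta_{n}y},$$ where $\alpha,\beta>0$, $a_m,b_n\in\mathbb{C}$, and $\xi_m,\eta_n\in\mathbb{C}$ satisfy $\operatorname{Re}(\xi_m)>0$ and $\operatorname{Re}(\eta_n)>0$ for all $1\le m\le M$, $1\le n\le N$. Then the probability density function $q(t)=\int_0^\infty f(ty)\,g(y)\,y\,dy$ of the quotient $X/Y$ can be written, for $t>0$, as $$q(t)=t^{\alpha-1}w(t),$$ where $$w(t)=\Gamma(\alpha+\beta)\sum_{m=1}^{M}\sum_{n=1}^{N}a_{m}b_{n}\left(\xi_{m}t+\eta_{n}\right)^{-\alpha-\beta}.$$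
   Context: $\Gamma$ is the gamma function. Complex powers are taken with the principal branch. The coefficients $a_m,b_n$ and exponents $\xi_m,\eta_n$ may be complex, but $f$ and $g$ are probability density functions supported on the non-negative half-line. *)

theory Defs
  imports "HOL-Probability.Probability"
begin

text \<open>
  Since \<^const>\<open>ennreal\<close> truncates negative reals to 0, non-negativity of a real-valued density
  has to be required separately.
\<close>

definition has_pdf :: "'a measure \<Rightarrow> ('a \<Rightarrow> real) \<Rightarrow> (real \<Rightarrow> real) \<Rightarrow> bool" where
  "has_pdf P X f \<longleftrightarrow> (\<forall>x. 0 \<le> f x) \<and> distributed P lborel X (\<lambda>x. ennreal (f x))"

definition quotient_pdf :: "(real \<Rightarrow> real) \<Rightarrow> (real \<Rightarrow> real) \<Rightarrow> real \<Rightarrow> real" where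
  "quotient_pdf f g t = (LBINT y:{0<..}. f (t * y) * g y * y)"

end

theory Submission
  imports Defs
begin

text \<open>
  The density of the quotient comes from the substitution \<open>x = t y\<close> in the joint density. Inserting
  the given \<open>f\<close> and \<open>g\<close>, everything reduces to
  \<open>\<integral>\<^sub>0\<^sup>\<infinity> y\<^sup>s\<^sup>-\<^sup>1 exp (- z y) dy = \<Gamma>(s) z\<^sup>-\<^sup>s\<close> for complex \<open>z\<close> with \<open>Re z > 0\<close>. This avoids
  contour rotation as follows: some real \<open>c > 0\<close> satisfies \<open>\<bar>z - c\<bar> < c\<close>, and integrating
  \<open>exp (- z y) = exp (- c y) \<Sum>k. ((c - z) y)\<^sup>k / k!\<close> termwise yields the binomial series of
  \<open>\<Gamma>(s) c\<^sup>-\<^sup>s (1 + (z - c) / c)\<^sup>-\<^sup>s\<close>.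
\<close>

text \<open>The substitution \<open>u = c * y\<close> in Euler's integral for
  \<open>Gamma s\<close>. As the integrand is non-negative, the computation runs in
  \<open>ennreal\<close>, so that integrability and the value come out together.\<close>

lemma has_bochner_integral_powr_exp_real:
  fixes s c :: real
  assumes "s > 0" "c > 0"
  shows "has_bochner_integral lborel
           (\<lambda>y. indicator {0<..} y * (y powr (s - 1) * exp (- (c * y)))) (Gamma s / c powr s)"
proof (rule has_bochner_integral_nn_integral)
  show "Gamma s / c powr s \<ge> 0"
    using assms by simp
  let ?F = "\<lambda>u. ennreal (indicator {0..} u * u powr (s - 1) / exp u)"
  have "ennreal (Gamma s) = ennreal \<bar>c\<bar> * (\<integral>\<^sup>+y. ?F (0 + c * y) \<partial>lborel)"
    unfolding Gamma_conv_nn_integral_real[OF assms(1)]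
    using assms by (intro nn_integral_real_affine) auto
  also have "(\<integral>\<^sup>+y. ?F (0 + c * y) \<partial>lborel) = (\<integral>\<^sup>+y. ennreal (c powr (s - 1)) *
      ennreal (indicator {0<..} y * (y powr (s - 1) * exp (- (c * y)))) \<partial>lborel)"
  \<comment> \<open>Euler's integral runs over the closed half-line, the target over the open one.
    The indicators differ only at 0, a null set.\<close>
  proof (rule nn_integral_cong_AE, use AE_lborel_singleton[of 0] in eventually_elim)
    case (elim y)
    have "indicator {0..} (c * y) = (indicator {0<..} y :: real)"
      using elim assms by (auto simp: indicator_def zero_le_mult_iff)
    then show ?case
      using assms
      by (cases "y > 0") (auto simp: powr_mult exp_minus field_simps ennreal_mult[symmetric])
  qed
  also have "\<dots> = ennreal (c powr (s - 1)) *
      (\<integral>\<^sup>+y. ennreal (indicator {0<..} y * (y powr (s - 1) * exp (- (c * y)))) \<partial>lborel)"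
    (is "_ = _ * ?I")
    by (rule nn_integral_cmult) auto
  finally have *: "ennreal (Gamma s) = ennreal (c powr s) * ?I"
    using assms by (simp add: mult.assoc[symmetric] ennreal_mult[symmetric] powr_diff)
  have "ennreal (Gamma s / c powr s) = ennreal (1 / c powr s) * ennreal (Gamma s)"
    using assms by (simp add: ennreal_mult[symmetric])
  also have "\<dots> = ?I"
    unfolding * using assms by (simp add: mult.assoc[symmetric] ennreal_mult[symmetric])
  finally show "?I = ennreal (Gamma s / c powr s)" ..
qed auto

lemma has_bochner_integral_powr_exp_complex:
  fixes s :: real and z :: complex
  assumes s: "s > 0" and z: "Re z > 0"
  shows "has_bochner_integral lborel
           (\<lambda>y. indicator {0<..} y *\<^sub>R (of_real (y powr (s - 1)) * exp (- z * of_real y)))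
           (of_real (Gamma s) * z powr of_real (- s))"
proof -
  \<comment> \<open>Geometrically, \<open>z\<close> lies in the disc of radius \<open>c\<close>
    around \<open>c\<close> once \<open>c\<close> exceeds \<open>(norm z)^2 / (2 * Re z)\<close>.
    Twice that bound gives \<open>c * Re z = (norm z)^2\<close>, which simplifies the expansion of
    the squared distance.\<close>
  define c where "c = (norm z)\<^sup>2 / Re z"
  have nz: "z \<noteq> 0" using z by auto
  have c: "c > 0" using z nz by (simp add: c_def)
  have "(norm (z - of_real c))\<^sup>2 = (norm z)\<^sup>2 - 2 * c * Re z + c\<^sup>2"
    unfolding cmod_power2 by (simp add: power2_eq_square algebra_simps)
  also have "\<dots> = c\<^sup>2 - (norm z)\<^sup>2" using z by (simp add: c_def)
  also have "\<dots> < c\<^sup>2" using nz by simp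
  finally have dist: "norm (z - of_real c) < c"
    using c by (meson less_le_not_le power2_less_imp_less)
  define w where "w = (z - of_real c) / of_real c"
  have w: "norm w < 1" using dist c by (simp add: w_def norm_divide)
  have zw: "z = of_real c * (1 + w)" using c by (simp add: w_def field_simps)
  define J where "J k y = indicator {0<..} y * (y powr (s + real k - 1) * exp (- (c * y)))" for k y
  have J: "has_bochner_integral lborel (J k) (Gamma s * c powr (- s) * pochhammer s k / c ^ k)" for k
  proof -
    \<comment> \<open>The real case with exponent \<open>s + k\<close> gives
      \<open>Gamma (s + k)\<close>; the quotient by \<open>Gamma s\<close> is the rising factorial,
      which becomes a generalized binomial coefficient below.\<close>
    have "s \<notin> \<int>\<^sub>\<le>\<^sub>0" using s nonpos_Ints_nonpos[of s] by auto
    then have "Gamma (s + real k) = pochhammer s k * Gamma s"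
      using pochhammer_Gamma[of s k] Gamma_real_pos[OF s] by (simp add: field_simps)
    then have "Gamma (s + real k) / c powr (s + real k) =
        Gamma s * c powr (- s) * pochhammer s k / c ^ k"
      using c by (simp add: powr_add powr_realpow powr_minus field_simps)
    with has_bochner_integral_powr_exp_real[of "s + real k" c] s c show ?thesis
      by (simp add: J_def[abs_def])
  qed
  have J_0: "J 0 y = y powr (s - 1) * exp (- (c * y))" if "y > 0" for y
    using that by (simp add: J_def)
  have J_shift: "J k y = J 0 y * y ^ k" for k y
    by (cases "y > 0") (simp_all add: J_def powr_add powr_diff powr_realpow)
  have J_nonneg: "J k y \<ge> 0" for k y by (simp add: J_def)
  define F where "F k y = of_real (J k y) * ((of_real c - z) ^ k / fact k)" for k y
  have F_int: "integrable lborel (F k)"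
    and F_integral: "(\<integral>y. F k y \<partial>lborel) =
      of_real (Gamma s * c powr (- s)) * ((of_real (- s) gchoose k) * w ^ k)"
    and F_norm: "(\<integral>y. norm (F k y) \<partial>lborel) =
      Gamma s * c powr (- s) * ((- s gchoose k) * (- norm w) ^ k)" for k
  proof -
    have cw: "of_real c - z = - (of_real c * w)" using zw by (simp add: algebra_simps)
    have *: "has_bochner_integral lborel (F k) (of_real (Gamma s * c powr (- s) * pochhammer s k / c ^ k) *
               ((of_real c - z) ^ k / fact k))"
      unfolding F_def by (intro has_bochner_integral_mult_left has_bochner_integral_of_real J)
    show "integrable lborel (F k)" using * by (rule integrable.intros)
    have "(\<integral>y. F k y \<partial>lborel) = of_real (Gamma s * c powr (- s) * pochhammer s k / c ^ k) *
               ((of_real c - z) ^ k / fact k)"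
      using * by (rule has_bochner_integral_integral_eq)
    also have "\<dots> = of_real (Gamma s * c powr (- s)) * ((of_real (- s) gchoose k) * w ^ k)"
      unfolding cw using c
      by (simp add: gbinomial_pochhammer pochhammer_of_real power_minus' power_mult_distrib)
    finally show "(\<integral>y. F k y \<partial>lborel) = \<dots>" .
    have "norm (F k y) = J k y * ((c * norm w) ^ k / fact k)" for y
      using J_nonneg[of k y] c unfolding F_def cw by (simp add: norm_mult norm_divide norm_power)
    then have "(\<integral>y. norm (F k y) \<partial>lborel) =
        Gamma s * c powr (- s) * pochhammer s k / c ^ k * ((c * norm w) ^ k / fact k)"
      by (simp add: has_bochner_integral_integral_eq[OF J])
    \<comment> \<open>The sign \<open>(-1)^k\<close> in \<open>- s gchoose k\<close> is cancelled by
      that of \<open>(- norm w) ^ k\<close>, so the norms again form a binomial series, now at the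
      real point \<open>- norm w\<close>.\<close>
    also have "\<dots> = Gamma s * c powr (- s) * ((- s gchoose k) * (- norm w) ^ k)"
      using c by (simp add: gbinomial_pochhammer power_mult_distrib power_minus[of "norm w"])
    finally show "(\<integral>y. norm (F k y) \<partial>lborel) = \<dots>" .
  qed
  have F_sums: "(\<lambda>k. F k y) sums
      (indicator {0<..} y *\<^sub>R (of_real (y powr (s - 1)) * exp (- z * of_real y)))"
    for y
  proof (cases "y > 0")
    case True
    have "(\<lambda>k. of_real (y powr (s - 1) * exp (- (c * y))) *
             (((of_real c - z) * of_real y) ^ k /\<^sub>R fact k)) sums
          (of_real (y powr (s - 1) * exp (- (c * y))) * exp ((of_real c - z) * of_real y))"
      by (intro sums_mult exp_converges)
    also have "(\<lambda>k. of_real (y powr (s - 1) * exp (- (c * y))) *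
             (((of_real c - z) * of_real y) ^ k /\<^sub>R fact k)) = (\<lambda>k. F k y)"
    proof
      fix k
      show "of_real (y powr (s - 1) * exp (- (c * y))) *
             (((of_real c - z) * of_real y) ^ k /\<^sub>R fact k) = F k y"
        using True J_0[of y]
        by (simp add: F_def J_shift[of k] power_mult_distrib scaleR_conv_of_real
            divide_inverse mult_ac)
    qed
    also have "of_real (y powr (s - 1) * exp (- (c * y))) * exp ((of_real c - z) * of_real y) =
        of_real (y powr (s - 1)) * exp (- z * of_real y)"
      by (simp add: exp_of_real[symmetric] exp_add[symmetric] algebra_simps)
    finally show ?thesis using True by simp
  qed (simp add: F_def J_def)
  have F_summable: "summable (\<lambda>k. norm (F k y))" for y
  proof (cases "y > 0")
    case True
    have "summable (\<lambda>k. J 0 y * (norm ((of_real c - z) * of_real y) ^ k /\<^sub>R fact k))"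
      using exp_converges by (intro summable_mult) (rule sums_summable)
    also have "(\<lambda>k. J 0 y * (norm ((of_real c - z) * of_real y) ^ k /\<^sub>R fact k)) = (\<lambda>k. norm (F k y))"
    proof
      fix k
      show "J 0 y * (norm ((of_real c - z) * of_real y) ^ k /\<^sub>R fact k) = norm (F k y)"
        using True J_nonneg[of 0 y]
        by (simp add: F_def J_shift[of k] norm_mult norm_power norm_inverse power_mult_distrib
            divide_inverse mult_ac)
    qed
    finally show ?thesis .
  qed (simp add: F_def J_def)
  \<comment> \<open>This licenses exchanging sum and integral: up to a constant the series is the
    one for \<open>(1 - norm w) powr (- s)\<close>, convergent since
    \<open>norm w < 1\<close>.\<close>
  have norm_summable: "summable (\<lambda>k. \<integral>y. norm (F k y) \<partial>lborel)"
    unfolding F_norm using gen_binomial_real[of "- norm w" "- s"] w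
    by (intro summable_mult sums_summable) auto
  have sums: "(\<lambda>k. \<integral>y. F k y \<partial>lborel) sums (\<integral>y. (\<Sum>k. F k y) \<partial>lborel)"
    and int: "integrable lborel (\<lambda>y. \<Sum>k. F k y)"
    using sums_integral[OF F_int _ norm_summable] integrable_suminf[OF F_int _ norm_summable]
      F_summable by auto
  have "(\<lambda>k. \<integral>y. F k y \<partial>lborel) sums
      (of_real (Gamma s * c powr (- s)) * (1 + w) powr of_real (- s))"
    unfolding F_integral by (intro sums_mult gen_binomial_complex w)
  with sums have "(\<integral>y. (\<Sum>k. F k y) \<partial>lborel) =
      of_real (Gamma s * c powr (- s)) * (1 + w) powr of_real (- s)"
    by (rule sums_unique2)
  \<comment> \<open>A positive real factor does not change the argument, so the principal power of
    \<open>c * (1 + w)\<close> splits.\<close>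
  also have "\<dots> = of_real (Gamma s) * z powr of_real (- s)"
    unfolding zw using c powr_of_real[of c "- s"] by (subst powr_times_real_left) auto
  finally show ?thesis
    using int F_sums[THEN sums_unique] by (simp add: has_bochner_integral_iff)
qed

text \<open>By independence the joint law has density \<open>p x * r y\<close>. For fixed
  \<open>y\<close> the substitution \<open>x = t * y\<close> has Jacobian
  \<open>\<bar>y\<bar>\<close>, as \<open>y\<close> may have either sign, and Tonelli then makes
  \<open>t\<close> the outer variable.\<close>

lemma (in prob_space) distributed_quotient:
  fixes X Y :: "'a \<Rightarrow> real"
  assumes indep: "indep_var borel X borel Y"
    and X: "distributed M lborel X p" and Y: "distributed M lborel Y r"
  shows "distributed M lborel (\<lambda>\<omega>. X \<omega> / Y \<omega>) (\<lambda>t. \<integral>\<^sup>+y. p (t * y) * r y * ennreal \<bar>y\<bar> \<partial>lborel)"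
proof -
  have [measurable]: "p \<in> borel_measurable borel" "r \<in> borel_measurable borel"
    "X \<in> borel_measurable M" "Y \<in> borel_measurable M"
    using X Y by (auto simp: distributed_def)
  have "distr M borel X \<Otimes>\<^sub>M distr M borel Y = distr M (borel \<Otimes>\<^sub>M borel) (\<lambda>\<omega>. (X \<omega>, Y \<omega>))"
    using indep by (simp add: indep_var_distribution_eq)
  moreover have "distr M borel X = density lborel p" "distr M borel Y = density lborel r"
    using X Y by (simp_all add: distributed_def cong: distr_cong)
  ultimately have joint: "distr M (borel \<Otimes>\<^sub>M borel) (\<lambda>\<omega>. (X \<omega>, Y \<omega>)) = density lborel p \<Otimes>\<^sub>M density lborel r"
    by simp
  \<comment> \<open>Needed to form the density of the product measure; this measure is the law of
    \<open>Y\<close>, hence a probability measure.\<close>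
  have "sigma_finite_measure (density lborel r)"
    using prob_space_distr[of Y borel] \<open>distr M borel Y = _\<close>
    by (auto intro: prob_space_imp_sigma_finite)
  then have dens: "density lborel p \<Otimes>\<^sub>M density lborel r =
      density (lborel \<Otimes>\<^sub>M lborel) (\<lambda>(x, y). p x * r y)"
    by (intro pair_measure_density) (auto simp: lborel.sigma_finite_measure_axioms)
  have "distr M lborel (\<lambda>\<omega>. X \<omega> / Y \<omega>) =
      density lborel (\<lambda>t. \<integral>\<^sup>+y. p (t * y) * r y * ennreal \<bar>y\<bar> \<partial>lborel)"
  proof (rule measure_eqI)
    fix A :: "real set" assume "A \<in> sets (distr M lborel (\<lambda>\<omega>. X \<omega> / Y \<omega>))"
    then have [measurable]: "A \<in> sets borel" by simp
    have "emeasure (distr M lborel (\<lambda>\<omega>. X \<omega> / Y \<omega>)) A =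
        (\<integral>\<^sup>+\<omega>. indicator A (X \<omega> / Y \<omega>) \<partial>M)"
      by (subst nn_integral_indicator[symmetric], simp, subst nn_integral_distr) auto
    also have "\<dots> = (\<integral>\<^sup>+v. indicator A (fst v / snd v) \<partial>distr M (borel \<Otimes>\<^sub>M borel) (\<lambda>\<omega>. (X \<omega>, Y \<omega>)))"
      by (subst nn_integral_distr) auto
    also have "\<dots> = (\<integral>\<^sup>+v. (p (fst v) * r (snd v)) * indicator A (fst v / snd v) \<partial>(lborel \<Otimes>\<^sub>M lborel))"
      unfolding joint dens by (subst nn_integral_density) (auto simp: case_prod_beta)
    also have "\<dots> = (\<integral>\<^sup>+y. \<integral>\<^sup>+x. p x * r y * indicator A (x / y) \<partial>lborel \<partial>lborel)"
      by (subst lborel_pair.nn_integral_snd[symmetric]) auto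
    also have "\<dots> = (\<integral>\<^sup>+y. \<integral>\<^sup>+t. p (t * y) * r y * ennreal \<bar>y\<bar> * indicator A t \<partial>lborel \<partial>lborel)"
    \<comment> \<open>The substitution requires a nonzero \<open>y\<close>. Dropping the null set
      where \<open>y = 0\<close> also disposes of the convention \<open>x / 0 = 0\<close>.\<close>
    proof (rule nn_integral_cong_AE, use AE_lborel_singleton[of 0] in eventually_elim)
      case (elim y)
      have "(\<integral>\<^sup>+x. p x * r y * indicator A (x / y) \<partial>lborel) =
          ennreal \<bar>y\<bar> * (\<integral>\<^sup>+t. p (0 + y * t) * r y * indicator A ((0 + y * t) / y) \<partial>lborel)"
        using elim by (intro nn_integral_real_affine) auto
      also have "\<dots> = (\<integral>\<^sup>+t. ennreal \<bar>y\<bar> * (p (0 + y * t) * r y * indicator A ((0 + y * t) / y)) \<partial>lborel)"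
        by (rule nn_integral_cmult[symmetric]) auto
      finally show ?case using elim by (simp add: mult_ac)
    qed
    also have "\<dots> = (\<integral>\<^sup>+t. \<integral>\<^sup>+y. p (t * y) * r y * ennreal \<bar>y\<bar> * indicator A t \<partial>lborel \<partial>lborel)"
      by (rule lborel_pair.Fubini') auto
    also have "\<dots> = emeasure (density lborel (\<lambda>t. \<integral>\<^sup>+y. p (t * y) * r y * ennreal \<bar>y\<bar> \<partial>lborel)) A"
      by (simp add: emeasure_density nn_integral_multc)
    finally show "emeasure (distr M lborel (\<lambda>\<omega>. X \<omega> / Y \<omega>)) A = \<dots>" .
  qed simp
  then show ?thesis by (simp add: distributed_def)
qed

text \<open>A Bochner integral has the default value 0 when its integrand is not integrable. The
  conclusion therefore asserts integrability for \<open>t > 0\<close> alongside the formula, so that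
  \<open>quotient_pdf\<close> is a genuine integral there.\<close>

theorem lemma2p4:
  fixes P :: "'a measure" and X Y :: "'a \<Rightarrow> real"
    and f g :: "real \<Rightarrow> real"
    and \<alpha> \<beta> :: real
    and M N :: nat
    and a b \<xi> \<eta> :: "nat \<Rightarrow> complex"
  assumes "prob_space P"
    and "prob_space.indep_var P borel X borel Y"
    and "AE \<omega> in P. 0 \<le> X \<omega>" and "AE \<omega> in P. 0 \<le> Y \<omega>"
    and "has_pdf P X f" and "has_pdf P Y g"
    and "\<And>x. x < 0 \<Longrightarrow> f x = 0" and "\<And>y. y < 0 \<Longrightarrow> g y = 0"
    and "\<And>x. x > 0 \<Longrightarrow> complex_of_real (f x) =
           of_real (x powr (\<alpha> - 1)) * (\<Sum>m=1..M. a m * exp (- \<xi> m * of_real x))"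
    and "\<And>y. y > 0 \<Longrightarrow> complex_of_real (g y) =
           of_real (y powr (\<beta> - 1)) * (\<Sum>n=1..N. b n * exp (- \<eta> n * of_real y))"
    and "\<alpha> > 0" and "\<beta> > 0"
    and "\<And>m. m \<in> {1..M} \<Longrightarrow> Re (\<xi> m) > 0"
    and "\<And>n. n \<in> {1..N} \<Longrightarrow> Re (\<eta> n) > 0"
  shows "has_pdf P (\<lambda>\<omega>. X \<omega> / Y \<omega>) (quotient_pdf f g) \<and>
    (\<forall>t>0. set_integrable lborel {0<..} (\<lambda>y. f (t * y) * g y * y) \<and>
      complex_of_real (quotient_pdf f g t) =
        of_real (t powr (\<alpha> - 1)) *
        (of_real (Gamma (\<alpha> + \<beta>)) *
          (\<Sum>m=1..M. \<Sum>n=1..N.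
            a m * b n * (\<xi> m * of_real t + \<eta> n) powr of_real (- \<alpha> - \<beta>))))"
proof -
  interpret prob_space P by fact
  note f = \<open>has_pdf P X f\<close> and g = \<open>has_pdf P Y g\<close>
  have f_nonneg: "f x \<ge> 0" and g_nonneg: "g x \<ge> 0" for x
    using f g by (auto simp: has_pdf_def)
  \<comment> \<open>\<open>distributed\<close> yields measurability only after the embedding into
    \<open>ennreal\<close>; non-negativity lets \<open>enn2real\<close> undo it.\<close>
  have "(\<lambda>x. enn2real (ennreal (f x))) \<in> borel_measurable borel"
    "(\<lambda>x. enn2real (ennreal (g x))) \<in> borel_measurable borel"
    using f g by (auto simp: has_pdf_def distributed_def)
  then have [measurable]: "f \<in> borel_measurable borel" "g \<in> borel_measurable borel"
    using f_nonneg g_nonneg by simp_all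
  let ?J = "\<lambda>t y. indicator {0<..} y *\<^sub>R (f (t * y) * g y * y)"
  have J_nonneg: "?J t y \<ge> 0" for t y
    using f_nonneg[of "t * y"] g_nonneg[of y] by (simp add: indicator_def)
  let ?V = "\<lambda>t. of_real (t powr (\<alpha> - 1)) * (of_real (Gamma (\<alpha> + \<beta>)) *
    (\<Sum>m=1..M. \<Sum>n=1..N. a m * b n * (\<xi> m * of_real t + \<eta> n) powr of_real (- \<alpha> - \<beta>)))"
  have J: "has_bochner_integral lborel (\<lambda>y. complex_of_real (?J t y)) (?V t)" if t: "t > 0" for t
  proof -
    \<comment> \<open>One exponential of \<open>f (t * y)\<close> times one of \<open>g y\<close>:
      the rates add up to \<open>\<xi> m * t + \<eta> n\<close>, and the powers of \<open>y\<close>,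
      including the Jacobian \<open>y\<close>, combine to \<open>\<alpha> + \<beta> - 1\<close>.
      Each such term is a complex Gamma integral.\<close>
    define E where "E m n y = indicator {0<..} y *\<^sub>R
      (of_real (y powr (\<alpha> + \<beta> - 1)) * exp (- (\<xi> m * of_real t + \<eta> n) * of_real y))" for m n y
    have E: "has_bochner_integral lborel (E m n)
        (of_real (Gamma (\<alpha> + \<beta>)) * (\<xi> m * of_real t + \<eta> n) powr of_real (- \<alpha> - \<beta>))"
      if "m \<in> {1..M}" "n \<in> {1..N}" for m n
    proof -
      have "- (\<alpha> + \<beta>) = - \<alpha> - \<beta>" by simp
      moreover have "Re (\<xi> m * of_real t + \<eta> n) > 0"
        using assms(13)[OF that(1)] assms(14)[OF that(2)] t by (simp add: add_pos_pos)
      ultimately show ?thesis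
        using has_bochner_integral_powr_exp_complex[of "\<alpha> + \<beta>" "\<xi> m * of_real t + \<eta> n"] assms(11,12)
        unfolding E_def[abs_def] by (metis add_pos_pos)
    qed
    have "has_bochner_integral lborel
        (\<lambda>y. \<Sum>m=1..M. \<Sum>n=1..N. (of_real (t powr (\<alpha> - 1)) * a m * b n) * E m n y)
        (\<Sum>m=1..M. \<Sum>n=1..N. (of_real (t powr (\<alpha> - 1)) * a m * b n) *
          (of_real (Gamma (\<alpha> + \<beta>)) * (\<xi> m * of_real t + \<eta> n) powr of_real (- \<alpha> - \<beta>)))"
      by (intro has_bochner_integral_sum has_bochner_integral_mult_right E)
    also have "(\<lambda>y. \<Sum>m=1..M. \<Sum>n=1..N. (of_real (t powr (\<alpha> - 1)) * a m * b n) * E m n y) =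
        (\<lambda>y. complex_of_real (?J t y))"
    proof
      fix y :: real
      show "(\<Sum>m=1..M. \<Sum>n=1..N. (of_real (t powr (\<alpha> - 1)) * a m * b n) * E m n y) =
          complex_of_real (?J t y)"
      proof (cases "y > 0")
        case True
        have pow: "t powr (\<alpha> - 1) * y powr (\<alpha> + \<beta> - 1) = (t * y) powr (\<alpha> - 1) * y powr (\<beta> - 1) * y"
          using True t by (simp add: powr_mult powr_add powr_diff field_simps)
        have "complex_of_real (?J t y) = of_real (f (t * y)) * of_real (g y) * of_real y"
          using True by simp
        also have "\<dots> = of_real ((t * y) powr (\<alpha> - 1) * y powr (\<beta> - 1) * y) *
            ((\<Sum>m=1..M. a m * exp (- \<xi> m * of_real (t * y))) * (\<Sum>n=1..N. b n * exp (- \<eta> n * of_real y)))"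
          using True t by (subst assms(9,10); simp)+
        also have "\<dots> = (\<Sum>m=1..M. \<Sum>n=1..N. of_real (t powr (\<alpha> - 1) * y powr (\<alpha> + \<beta> - 1)) *
            ((a m * exp (- \<xi> m * of_real (t * y))) * (b n * exp (- \<eta> n * of_real y))))"
          unfolding pow sum_product by (simp add: sum_distrib_left)
        also have "\<dots> = (\<Sum>m=1..M. \<Sum>n=1..N. (of_real (t powr (\<alpha> - 1)) * a m * b n) * E m n y)"
          using True by (intro sum.cong refl) (simp add: E_def exp_diff exp_minus exp_add divide_inverse algebra_simps)
        finally show ?thesis ..
      qed (simp add: E_def)
    qed
    also have "(\<Sum>m=1..M. \<Sum>n=1..N. (of_real (t powr (\<alpha> - 1)) * a m * b n) *
          (of_real (Gamma (\<alpha> + \<beta>)) * (\<xi> m * of_real t + \<eta> n) powr of_real (- \<alpha> - \<beta>))) = ?V t"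
      by (simp add: sum_distrib_left mult_ac)
    finally show ?thesis .
  qed
  have J_int: "integrable lborel (?J t)" if "t > 0" for t
    using has_bochner_integral_Re[OF J[OF that]] by (auto intro: integrable.intros)
  have q: "quotient_pdf f g t = (\<integral>y. ?J t y \<partial>lborel)" for t
    by (simp add: quotient_pdf_def set_lebesgue_integral_def)
  have q_eq: "complex_of_real (quotient_pdf f g t) = ?V t" if "t > 0" for t
    unfolding q using has_bochner_integral_integral_eq[OF J[OF that]] by (simp del: of_real_mult)
  have q_nonneg: "quotient_pdf f g t \<ge> 0" for t
    unfolding q using J_nonneg by (intro integral_nonneg_AE) auto
  have [measurable]: "quotient_pdf f g \<in> borel_measurable borel"
    unfolding q[abs_def] by measurable
  let ?d = "\<lambda>t. \<integral>\<^sup>+y. ennreal (f (t * y)) * ennreal (g y) * ennreal \<bar>y\<bar> \<partial>lborel"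
  \<comment> \<open>The value \<open>f 0\<close> is not prescribed by the formula, so
    \<open>t = 0\<close> is set aside; densities matter only almost everywhere. For
    \<open>t < 0\<close> the integrand vanishes, because \<open>f\<close> does on the negative
    axis.\<close>
  have "?d t = ennreal (quotient_pdf f g t)" if t: "t \<noteq> 0" for t
  proof -
    have int: "integrable lborel (?J t)"
    proof (cases "t > 0")
      case False
      with t have "?J t = (\<lambda>_. 0)"
        using assms(7)[of "t * _"] by (auto simp: fun_eq_iff indicator_def mult_neg_pos)
      then show ?thesis by (simp only: integrable_zero)
    qed (rule J_int)
    have "?d t = (\<integral>\<^sup>+y. ennreal (?J t y) \<partial>lborel)"
    \<comment> \<open>The integral over the whole line reduces to the positive half-line since
      \<open>g\<close> vanishes for negative \<open>y\<close>; there \<open>\<bar>y\<bar>\<close> is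
      \<open>y\<close>.\<close>
    proof (rule nn_integral_cong_AE, use AE_lborel_singleton[of 0] in eventually_elim)
      case (elim y)
      then show ?case
        using f_nonneg[of "t * y"] g_nonneg[of y] assms(8)[of y]
        by (cases "y > 0") (auto simp: ennreal_mult)
    qed
    also have "\<dots> = ennreal (quotient_pdf f g t)"
      unfolding q using int J_nonneg by (intro nn_integral_eq_integral) auto
    finally show ?thesis .
  qed
  then have "AE t in lborel. ?d t = ennreal (quotient_pdf f g t)"
    using AE_lborel_singleton[of "0::real"] by (auto elim: eventually_mono)
  moreover have "distributed P lborel (\<lambda>\<omega>. X \<omega> / Y \<omega>) ?d"
    using f g assms(2) by (intro distributed_quotient) (auto simp: has_pdf_def)
  ultimately have "distributed P lborel (\<lambda>\<omega>. X \<omega> / Y \<omega>) (\<lambda>t. ennreal (quotient_pdf f g t))"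
    by (subst (asm) distributed_cong_density) auto
  then show ?thesis
    using q_nonneg J_int q_eq by (auto simp: has_pdf_def set_integrable_def)
qed

end
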